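(* Let $A$ be a finite set of $n:=|A|\ge 6$ integers with $\min(A)=0$ and $\gcd(A)=1$, and let $l:=\max(A)$. Let $\mathcal{E}$ be the exceptional set of $A$ and $\mathcal{E}'$ the exceptional set of $l-A=\{l-a\colon a\in A\}$. Let $m$ be an integer with $$ m\ge\max\Big\{\,l-\tfrac32\,n+\tfrac92,\ \tfrac23\,(l-n+2)\Big\}. $$ If neither $\{0,1\}\subseteq A\subseteq\{0,1\}\cup[m+2,l]$ nor $\{l-1,l\}\subseteq A\subseteq[0,l-(m+2)]\cup\{l-1,l\}$ holds, then $$ mA=[0,ml]\setminus\big(\mathcal{E}\cup(ml-\mathcal{E}')\big). $$ If either $\{0,1\}\subseteq A\subseteq\{0,1\}\cup[m+2,l]$ or $\{l-1,l\}\subseteq A\subseteq[0,l-(m+2)]\cup\{l-1,l\}$, then this equality does not hold.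
   Context: For a finite set $A$ of integers and a positive integer $m$, $mA:=\{a_1+\dots+a_m\colon a_1,\dots,a_m\in A\}$ is the $m$-fold sumset (summands not necessarily distinct). For integers $x\le y$, $[x,y]$ denotes the set of integers $z$ with $x\le z\le y$ (empty if $x>y$). For a set $B$ of integers and an integer $c$, $c-B:=\{c-b\colon b\in B\}$. The exceptional set of a finite set $B$ of nonnegative integers with $\min(B)=0$ and $\gcd(B)=1$ is the set of all positive integers that cannot be written as a nonnegative integer linear combination of elements of $B$. *)

theory Defs
  imports Complex_Main
begin

definition mfold_sumset :: "nat \<Rightarrow> int set \<Rightarrow> int set" where
  "mfold_sumset m A = {\<Sum>i<m. a i | a. \<forall>i<m. a i \<in> A}"

text \<open>Only meant for finite sets \<open>B\<close> of nonnegative integers with \<open>Min B = 0\<close> and \<open>Gcd B = 1\<close>.\<close>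

definition exceptional_set :: "int set \<Rightarrow> int set" where
  "exceptional_set B = {x. x > 0 \<and> \<not> (\<exists>c :: int \<Rightarrow> nat. x = (\<Sum>b\<in>B. int (c b) * b))}"

end

theory Submission
  imports Defs "HOL-Library.Multiset"
begin

text \<open>
  Suppose that \<open>u\<close> is in the semigroup generated by \<open>A\<close>, \<open>ml - u\<close> in that generated by \<open>l - A\<close>,
  but \<open>u\<close> is not in \<open>mA\<close>. After enlarging \<open>m\<close> one may assume that \<open>u\<close> and \<open>u + l\<close> both lie in
  \<open>(m+1)A\<close>. Represent these two numbers by as few summands as possible apart from \<open>0\<close> and \<open>l\<close>.
  A subsum of two or more of the remaining summands \<open>E\<close> and \<open>G\<close> is modulo \<open>l\<close> outside \<open>A\<close>, that is,
  a hole, since otherwise it could be replaced by one element of \<open>A\<close> and copies of \<open>0\<close> and \<open>l\<close>.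
  Whenever a subsum of \<open>E\<close> agrees modulo \<open>l\<close> with one of \<open>G\<close>, the corresponding parts can be
  exchanged; a shortest way to walk from \<open>0\<close> along \<open>E\<close> and then along \<open>G\<close> to the class of \<open>u\<close>
  visits at least \<open>m + 2\<close> distinct classes.

  If \<open>E\<close> and \<open>G\<close> both have at least three elements, then \<open>u\<close> is not a sum of two elements of \<open>A\<close>
  modulo \<open>l\<close>, so \<open>u - A\<close> consists of holes as well. It meets the walk in at most three
  classes, and there are more holes than the \<open>l - n + 1\<close> available. Otherwise, up to the reflection
  \<open>a \<mapsto> l - a\<close>, \<open>u < l\<close> is the sum of the \<open>m + 1\<close> elements of \<open>E\<close>; counting holes in pairs
  \<open>{c, u - c}\<close> gives \<open>u \<le> 2m - 1\<close>, which forces \<open>E\<close> to consist of ones only.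
\<close>

section \<open>Multisets and intervals\<close>

lemma set_mset_subset_image_iff:
  "set_mset X \<subseteq> f ` A \<longleftrightarrow> (\<exists>Y. set_mset Y \<subseteq> A \<and> X = image_mset f Y)"
proof
  assume "set_mset X \<subseteq> f ` A"
  then show "\<exists>Y. set_mset Y \<subseteq> A \<and> X = image_mset f Y"
  proof (induction X)
    case (add x X)
    then obtain a Y where "a \<in> A" "x = f a" "set_mset Y \<subseteq> A" "X = image_mset f Y" by auto
    then show ?case by (intro exI[of _ "add_mset a Y"]) simp
  qed simp
qed (auto simp: subset_image_iff)

lemma mset_take_mono:
  assumes "p \<le> q"
  shows "mset (take p xs) \<subseteq># mset (take q xs)"
proof -
  have "take p xs = take p (take q xs)" using assms by (simp add: min_absorb1)
  then show ?thesis by (metis append_take_drop_id mset_append mset_subset_eq_add_left)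
qed

lemma ex_mset_prefixes:
  assumes "X \<subseteq># Y" "Y \<subseteq># Z"
  obtains zs where "mset zs = Z" "mset (take (size X) zs) = X" "mset (take (size Y) zs) = Y"
proof -
  obtain xs ys ys' where "mset xs = X" "mset ys = Y - X" "mset ys' = Z - Y"
    using ex_mset by metis
  then have prefixes: "mset xs = X" "mset (xs @ ys) = Y" "mset (xs @ ys @ ys') = Z"
    using assms by (simp_all add: union_assoc[symmetric])
  moreover have "size X = length xs" "size Y = length (xs @ ys)"
    using prefixes(1,2) by (metis size_mset)+
  ultimately show thesis
    using that[of "xs @ ys @ ys'"] by simp
qed

lemma ex_symmetric_pair:
  fixes a b :: int
  assumes "K \<subseteq> {a..b}" "card {a..b} < 2 * card K"
  obtains x where "x \<in> K" "a + b - x \<in> K"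
proof -
  have "finite K" using assms(1) finite_subset by auto
  have "K \<inter> (-) (a + b) ` K \<noteq> {}"
  proof
    assume "K \<inter> (-) (a + b) ` K = {}"
    then have "2 * card K = card (K \<union> (-) (a + b) ` K)"
      using \<open>finite K\<close> by (simp add: card_Un_disjoint card_image)
    also have "\<dots> \<le> card {a..b}"
      using assms(1) by (intro card_mono) auto
    finally show False using assms(2) by simp
  qed
  then show thesis using that by auto
qed


section \<open>Sumsets and the semigroup generated by a set\<close>

lemma mfold_sumset_eq_sum_mset:
  "mfold_sumset m A = {sum_mset X |X. set_mset X \<subseteq> A \<and> size X = m}"
proof (intro equalityI subsetI)
  fix u assume "u \<in> mfold_sumset m A"
  then obtain a where a: "\<forall>i<m. a i \<in> A" "u = (\<Sum>i<m. a i)"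
    unfolding mfold_sumset_def by blast
  define X where "X = image_mset a (mset_set {..<m})"
  have "set_mset X \<subseteq> A" "size X = m" "u = sum_mset X"
    using a by (auto simp: X_def sum_unfold_sum_mset)
  then show "u \<in> {sum_mset X |X. set_mset X \<subseteq> A \<and> size X = m}" by blast
next
  fix u assume "u \<in> {sum_mset X |X. set_mset X \<subseteq> A \<and> size X = m}"
  then obtain X where X: "set_mset X \<subseteq> A" "size X = m" "u = sum_mset X" by blast
  obtain xs where xs: "mset xs = X" using ex_mset by blast
  have "u = (\<Sum>i<m. xs ! i)"
    using X xs by (metis sum_mset_sum_list sum_list_sum_nth size_mset atLeast0LessThan)
  moreover have "\<forall>i<m. xs ! i \<in> A"
    using X xs by (metis nth_mem set_mset_mset size_mset subsetD)
  ultimately show "u \<in> mfold_sumset m A"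
    unfolding mfold_sumset_def by blast
qed

definition nat_span :: "int set \<Rightarrow> int set" where
  "nat_span A = {sum_mset X |X. set_mset X \<subseteq> A}"

lemma nat_spanI: "set_mset X \<subseteq> A \<Longrightarrow> sum_mset X \<in> nat_span A"
  unfolding nat_span_def by blast

lemma zero_in_nat_span: "0 \<in> nat_span A"
  using nat_spanI[of "{#}"] by simp

lemma mfold_sumset_subset_nat_span: "mfold_sumset m A \<subseteq> nat_span A"
  unfolding mfold_sumset_eq_sum_mset nat_span_def by blast

lemma nat_span_eq_range:
  assumes "finite A"
  shows "nat_span A = range (\<lambda>c :: int \<Rightarrow> nat. \<Sum>b\<in>A. int (c b) * b)"
proof (intro equalityI subsetI)
  fix u assume "u \<in> nat_span A"
  then obtain X where X: "set_mset X \<subseteq> A" "u = sum_mset X"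
    unfolding nat_span_def by blast
  have "sum_mset X = (\<Sum>b\<in>A. int (count X b) * b)"
    using X(1)
  proof (induction X)
    case (add x X)
    have "(\<Sum>b\<in>A. int (count (add_mset x X) b) * b)
        = (\<Sum>b\<in>A. int (count X b) * b + (if b = x then b else 0))"
      by (rule sum.cong) (auto simp: algebra_simps)
    also have "\<dots> = sum_mset X + x"
      using add assms by (simp add: sum.distrib)
    finally show ?case by simp
  qed simp
  then show "u \<in> range (\<lambda>c :: int \<Rightarrow> nat. \<Sum>b\<in>A. int (c b) * b)" using X(2) by blast
next
  fix u assume "u \<in> range (\<lambda>c :: int \<Rightarrow> nat. \<Sum>b\<in>A. int (c b) * b)"
  then obtain c :: "int \<Rightarrow> nat" where "u = (\<Sum>b\<in>A. int (c b) * b)" by blast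
  moreover have "sum_mset (\<Sum>b\<in>A. replicate_mset (c b) b) = (\<Sum>b\<in>A. int (c b) * b)"
    using assms by (induction A) auto
  moreover have "set_mset (\<Sum>b\<in>A. replicate_mset (c b) b) \<subseteq> A"
    using assms by (auto simp: set_mset_sum split: if_splits)
  ultimately show "u \<in> nat_span A" by (metis nat_spanI)
qed

lemma exceptional_set_eq:
  assumes "finite A"
  shows "exceptional_set A = {0<..} - nat_span A"
  unfolding exceptional_set_def nat_span_eq_range[OF assms] by auto


section \<open>Reflection\<close>

text \<open>
  A multiset \<open>X\<close> over \<open>A\<close> stands for the lattice point \<open>(sum_mset X, cosum l X)\<close>,
  whose coordinates are exchanged by the reflection at \<open>l\<close>.
\<close>

definition cosum :: "int \<Rightarrow> int multiset \<Rightarrow> int" where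
  "cosum l X = (\<Sum>a\<in>#X. l - a)"

lemma cosum_simps [simp]:
  "cosum l {#} = 0"
  "cosum l (add_mset a X) = l - a + cosum l X"
  "cosum l (X + Y) = cosum l X + cosum l Y"
  by (simp_all add: cosum_def)

lemma cosum_eq: "cosum l X = int (size X) * l - sum_mset X"
  by (induction X) (auto simp: algebra_simps)

lemma sum_mset_reflect [simp]: "sum_mset (image_mset ((-) l) X) = cosum l X"
  by (simp add: cosum_def)

lemma cosum_reflect [simp]: "cosum l (image_mset ((-) l) X) = sum_mset X"
  by (induction X) auto

lemma image_reflect_reflect [simp]: "(-) l ` (-) l ` A = A" for l :: int
  by (simp add: image_image)

lemma card_reflect: "card ((-) l ` A) = card A" for l :: int
  by (simp add: card_image)

lemma image_mset_reflect_reflect [simp]: "image_mset ((-) l) (image_mset ((-) l) X) = X" for l :: int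
  by (simp add: image_mset.compositionality comp_def)

lemma nat_span_reflect: "nat_span ((-) l ` A) = {cosum l Y |Y. set_mset Y \<subseteq> A}"
  unfolding nat_span_def set_mset_subset_image_iff by (metis sum_mset_reflect)

lemma nat_span_reflectI: "set_mset Y \<subseteq> A \<Longrightarrow> cosum l Y \<in> nat_span ((-) l ` A)"
  unfolding nat_span_reflect by blast

lemma mfold_sumset_reflect_iff:
  "u \<in> mfold_sumset m ((-) l ` A) \<longleftrightarrow> int m * l - u \<in> mfold_sumset m A"
proof -
  have "int m * l - v \<in> mfold_sumset m ((-) l ` B)" if v: "v \<in> mfold_sumset m B" for v B
  proof -
    obtain X where "set_mset X \<subseteq> B" "size X = m" "sum_mset X = v"
      using v unfolding mfold_sumset_eq_sum_mset by blast
    then show ?thesis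
      unfolding mfold_sumset_eq_sum_mset
      by (intro CollectI exI[of _ "image_mset ((-) l) X"]) (simp add: cosum_eq image_mono)
  qed
  from this[of u "(-) l ` A"] this[of "int m * l - u" A] show ?thesis by auto
qed

definition structured :: "int set \<Rightarrow> int \<Rightarrow> nat \<Rightarrow> bool" where
  "structured A l m \<longleftrightarrow>
    (\<forall>u \<in> nat_span A. int m * l - u \<in> nat_span ((-) l ` A) \<longrightarrow> u \<in> mfold_sumset m A)"

lemma structured_reflect_iff [simp]: "structured ((-) l ` A) l m \<longleftrightarrow> structured A l m"
proof -
  have "structured ((-) l ` B) l m" if B: "structured B l m" for B
    unfolding structured_def mfold_sumset_reflect_iff image_reflect_reflect
    using B unfolding structured_def by simp
  from this[of A] this[of "(-) l ` A"] show ?thesis by auto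
qed

definition isolated_one :: "int set \<Rightarrow> int \<Rightarrow> nat \<Rightarrow> bool" where
  "isolated_one A l m \<longleftrightarrow> {0, 1} \<subseteq> A \<and> A \<subseteq> {0, 1} \<union> {int m + 2..l}"

lemma isolated_one_antimono: "isolated_one A l m \<Longrightarrow> k \<le> m \<Longrightarrow> isolated_one A l k"
  unfolding isolated_one_def by fastforce

lemma isolated_one_reflect_iff:
  "isolated_one ((-) l ` A) l m \<longleftrightarrow>
    {l - 1, l} \<subseteq> A \<and> A \<subseteq> {0..l - (int m + 2)} \<union> {l - 1, l}"
proof -
  have mem: "b \<in> (-) l ` A \<longleftrightarrow> l - b \<in> A" for b by (auto simp: image_iff intro: bexI[of _ "l - b"])
  have "(-) l ` A \<subseteq> {0, 1} \<union> {int m + 2..l} \<longleftrightarrow>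
      (\<forall>a\<in>A. l - a \<in> {0, 1} \<union> {int m + 2..l})"
    by (rule image_subset_iff)
  also have "\<dots> \<longleftrightarrow> A \<subseteq> {0..l - (int m + 2)} \<union> {l - 1, l}"
    unfolding subset_eq by (intro ball_cong refl) auto
  finally show ?thesis unfolding isolated_one_def insert_subset mem by auto
qed


section \<open>Padding by the end points\<close>

definition extends_to :: "int \<Rightarrow> int multiset \<Rightarrow> nat \<Rightarrow> int \<Rightarrow> bool" where
  "extends_to l Y h u \<longleftrightarrow> (\<exists>p q. size Y + p + q = h \<and> sum_mset Y + int p * l = u)"

lemma extends_toI: "size Y + p + q = h \<Longrightarrow> sum_mset Y + int p * l = u \<Longrightarrow> extends_to l Y h u"
  unfolding extends_to_def by blast

lemma extends_to_iff:
  assumes "l > 0"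
  shows "extends_to l Y h u \<longleftrightarrow>
    sum_mset Y mod l = u mod l \<and> sum_mset Y \<le> u \<and> cosum l Y \<le> int h * l - u" (is "_ \<longleftrightarrow> ?between")
proof
  assume "extends_to l Y h u"
  then obtain p q where "h = size Y + p + q" "u = sum_mset Y + int p * l"
    unfolding extends_to_def by auto
  then show ?between using assms by (simp add: cosum_eq algebra_simps)
next
  assume between: ?between
  then obtain d where d: "u - sum_mset Y = l * d" by (metis mod_eq_dvd_iff dvdE)
  moreover have "0 \<le> l * d" using d between by linarith
  ultimately obtain p where p: "d = int p"
    using assms by (metis zero_le_imp_eq_int zero_le_mult_iff not_less)
  have "(int (size Y) + int p) * l \<le> int h * l"
    using between d p by (simp add: cosum_eq algebra_simps)
  then have "size Y + p \<le> h" using assms by simp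
  then show "extends_to l Y h u"
    using d p by (intro extends_toI[of _ p "h - (size Y + p)"]) (auto simp: algebra_simps)
qed

lemma extends_to_mono:
  assumes "extends_to l Y h u" "h \<le> k"
  shows "extends_to l Y k u"
proof -
  obtain p q where "size Y + p + q = h" "sum_mset Y + int p * l = u"
    using assms(1) unfolding extends_to_def by blast
  then show ?thesis using assms(2) by (intro extends_toI[of _ p "q + (k - h)"]) auto
qed

lemma extends_to_trans:
  assumes "extends_to l Z (size Y) (sum_mset Y)" "extends_to l Y h u"
  shows "extends_to l Z h u"
proof -
  obtain p q p' q' where "size Z + p + q = size Y" "sum_mset Z + int p * l = sum_mset Y"
    "size Y + p' + q' = h" "sum_mset Y + int p' * l = u"
    using assms unfolding extends_to_def by blast
  then show ?thesis by (intro extends_toI[of _ "p + p'" "q + q'"]) (auto simp: algebra_simps)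
qed

lemma extends_to_add:
  assumes "extends_to l W (size Y) (sum_mset Y)"
  shows "extends_to l (W + Z) (size (Y + Z)) (sum_mset (Y + Z))"
proof -
  obtain p q where "size W + p + q = size Y" "sum_mset W + int p * l = sum_mset Y"
    using assms unfolding extends_to_def by blast
  then show ?thesis by (intro extends_toI[of _ p q]) auto
qed

lemma extends_to_reflect:
  assumes "extends_to l Y h u"
  shows "extends_to l (image_mset ((-) l) Y) h (int h * l - u)"
proof -
  obtain p q where "h = size Y + p + q" "u = sum_mset Y + int p * l"
    using assms unfolding extends_to_def by blast
  then show ?thesis by (intro extends_toI[of _ q p]) (auto simp: cosum_eq algebra_simps)
qed

definition tight :: "int set \<Rightarrow> int \<Rightarrow> int multiset \<Rightarrow> bool" where
  "tight A l X \<longleftrightarrow> set_mset X \<subseteq> A \<and>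
    (\<forall>Y. set_mset Y \<subseteq> A \<and> extends_to l Y (size X) (sum_mset X) \<longrightarrow> size X \<le> size Y)"

lemma tight_imp_subset: "tight A l X \<Longrightarrow> set_mset X \<subseteq> A"
  by (simp add: tight_def)

lemma tight_size_le:
  "tight A l X \<Longrightarrow> set_mset Y \<subseteq> A \<Longrightarrow> extends_to l Y (size X) (sum_mset X) \<Longrightarrow> size X \<le> size Y"
  by (simp add: tight_def)

lemma ex_tight_extends_to:
  assumes "set_mset X \<subseteq> A" "extends_to l X h u"
  obtains Y where "tight A l Y" "extends_to l Y h u"
proof -
  obtain Y where Y: "set_mset Y \<subseteq> A" "extends_to l Y h u"
    and minimal: "\<And>Z. set_mset Z \<subseteq> A \<Longrightarrow> extends_to l Z h u \<Longrightarrow> size Y \<le> size Z"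
    using ex_has_least_nat[of "\<lambda>Y. set_mset Y \<subseteq> A \<and> extends_to l Y h u" X size] assms by blast
  have "tight A l Y"
    unfolding tight_def using Y minimal extends_to_trans by blast
  then show thesis using Y(2) that by blast
qed

lemma tight_mono:
  assumes "tight A l X" "Y \<subseteq># X"
  shows "tight A l Y"
  unfolding tight_def
proof (intro conjI allI impI)
  obtain Z where X: "X = Y + Z" using assms(2) by (metis subset_mset.le_iff_add)
  show "set_mset Y \<subseteq> A" using tight_imp_subset[OF assms(1)] X by simp
  fix W assume W: "set_mset W \<subseteq> A \<and> extends_to l W (size Y) (sum_mset Y)"
  then have "size X \<le> size (W + Z)"
    using tight_imp_subset[OF assms(1)] X extends_to_add[of l W Y Z]
    by (intro tight_size_le[OF assms(1)]) auto
  then show "size Y \<le> size W" using X by simp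
qed

lemma tight_reflect:
  assumes "tight A l X"
  shows "tight ((-) l ` A) l (image_mset ((-) l) X)"
  unfolding tight_def set_mset_subset_image_iff
proof (intro conjI allI impI; (elim conjE exE)?)
  show "\<exists>Y. set_mset Y \<subseteq> A \<and> image_mset ((-) l) X = image_mset ((-) l) Y"
    using tight_imp_subset[OF assms] by blast
  fix Y Z assume Z: "set_mset Z \<subseteq> A" "Y = image_mset ((-) l) Z"
    and "extends_to l Y (size (image_mset ((-) l) X)) (sum_mset (image_mset ((-) l) X))"
  then have "extends_to l Z (size X) (sum_mset X)"
    using extends_to_reflect[of l Y "size X" "cosum l X"] by (simp add: cosum_eq)
  then show "size (image_mset ((-) l) X) \<le> size Y"
    using tight_size_le[OF assms Z(1)] Z(2) by simp
qed

lemma tight_size_le_if_sum_eq: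
  assumes "tight A l X" "set_mset Y \<subseteq> A" "sum_mset Y = sum_mset X"
  shows "size X \<le> size Y"
proof (rule ccontr)
  assume "\<not> size X \<le> size Y"
  moreover from this have "extends_to l Y (size X) (sum_mset X)"
    using assms(3) by (intro extends_toI[of _ 0 "size X - size Y"]) auto
  ultimately show False using tight_size_le[OF assms(1,2)] by blast
qed

lemma tight_size_le_if_cosum_eq:
  assumes "tight A l X" "set_mset Y \<subseteq> A" "cosum l Y = cosum l X"
  shows "size X \<le> size Y"
  using tight_size_le_if_sum_eq[OF tight_reflect[OF assms(1)], of "image_mset ((-) l) Y"] assms(2,3)
  by (simp add: image_mono)


section \<open>Subsums of tight multisets\<close>

locale normalized_set =
  fixes A :: "int set" and l :: int
  assumes subset_atLeastAtMost: "A \<subseteq> {0..l}" and zero_in: "0 \<in> A" and l_in: "l \<in> A"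
    and l_pos: "l > 0"
begin

lemma finite_A: "finite A"
  using subset_atLeastAtMost by (rule finite_subset) simp

lemma normalized_set_reflect: "normalized_set ((-) l ` A) l"
  using subset_atLeastAtMost zero_in l_in l_pos by unfold_locales (auto simp: image_iff)

lemma mod_in: "a \<in> A \<Longrightarrow> a mod l \<in> A"
  using subset_atLeastAtMost zero_in by (cases "a = l") force+

definition holes :: "int set" where
  "holes = {0..l} - A"

lemma card_holes: "int (card holes) = l + 1 - int (card A)"
proof -
  have "card A \<le> card {0..l}" using subset_atLeastAtMost by (intro card_mono) auto
  then show ?thesis
    using card_Diff_subset[OF finite_A subset_atLeastAtMost] l_pos by (simp add: holes_def)
qed

lemma sum_mset_nonneg: "set_mset X \<subseteq> A \<Longrightarrow> sum_mset X \<ge> 0"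
  using subset_atLeastAtMost by (induction X) auto

lemma cosum_nonneg: "set_mset X \<subseteq> A \<Longrightarrow> cosum l X \<ge> 0"
  using subset_atLeastAtMost by (induction X) auto

lemma sum_mset_mono_subset:
  assumes "X \<subseteq># Y" "set_mset Y \<subseteq> A"
  shows "sum_mset X \<le> sum_mset Y"
proof -
  obtain Z where "Y = X + Z" using assms(1) by (metis subset_mset.le_iff_add)
  then show ?thesis using assms(2) sum_mset_nonneg[of Z] by auto
qed

lemma cosum_mono_subset:
  assumes "X \<subseteq># Y" "set_mset Y \<subseteq> A"
  shows "cosum l X \<le> cosum l Y"
proof -
  obtain Z where "Y = X + Z" using assms(1) by (metis subset_mset.le_iff_add)
  then show ?thesis using assms(2) cosum_nonneg[of Z] by auto
qed

lemma mfold_sumset_iff_extends_to: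
  "u \<in> mfold_sumset h A \<longleftrightarrow> (\<exists>Y. set_mset Y \<subseteq> A \<and> extends_to l Y h u)"
proof
  assume "u \<in> mfold_sumset h A"
  then obtain Y where "set_mset Y \<subseteq> A" "size Y = h" "sum_mset Y = u"
    unfolding mfold_sumset_eq_sum_mset by blast
  then show "\<exists>Y. set_mset Y \<subseteq> A \<and> extends_to l Y h u"
    by (intro exI[of _ Y]) (auto intro: extends_toI[of _ 0 0])
next
  assume "\<exists>Y. set_mset Y \<subseteq> A \<and> extends_to l Y h u"
  then obtain Y p q where "set_mset Y \<subseteq> A" "size Y + p + q = h" "sum_mset Y + int p * l = u"
    unfolding extends_to_def by blast
  moreover from this have "set_mset (Y + replicate_mset p l + replicate_mset q 0) \<subseteq> A"
    using zero_in l_in by (auto split: if_splits)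
  ultimately show "u \<in> mfold_sumset h A"
    unfolding mfold_sumset_eq_sum_mset
    by (intro CollectI exI[of _ "Y + replicate_mset p l + replicate_mset q 0"]) simp
qed

lemma mfold_sumset_mono: "h \<le> k \<Longrightarrow> mfold_sumset h A \<subseteq> mfold_sumset k A"
  unfolding subset_iff mfold_sumset_iff_extends_to using extends_to_mono by blast

lemma mfold_sumset_eq_iff_structured:
  "mfold_sumset m A =
      {0..int m * l} - (exceptional_set A \<union> (-) (int m * l) ` exceptional_set ((-) l ` A)) \<longleftrightarrow>
    structured A l m"
proof -
  have span_nonneg: "u \<ge> 0" if "u \<in> nat_span A" for u
    using that sum_mset_nonneg unfolding nat_span_def by blast
  have cospan_nonneg: "u \<ge> 0" if "u \<in> nat_span ((-) l ` A)" for u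
    using that cosum_nonneg unfolding nat_span_reflect by blast
  have mem_iff: "u \<in> {0..int m * l} -
        (exceptional_set A \<union> (-) (int m * l) ` exceptional_set ((-) l ` A)) \<longleftrightarrow>
      u \<in> nat_span A \<and> int m * l - u \<in> nat_span ((-) l ` A)" for u
  proof -
    have "u \<in> (-) (int m * l) ` exceptional_set ((-) l ` A) \<longleftrightarrow>
        int m * l - u \<in> exceptional_set ((-) l ` A)"
      by (auto simp: image_iff intro: bexI[of _ "int m * l - u"])
    then show ?thesis
      using span_nonneg cospan_nonneg zero_in_nat_span
      by (simp add: exceptional_set_eq finite_A) (smt (verit))
  qed
  have "int m * l - u \<in> nat_span ((-) l ` A)" if "u \<in> mfold_sumset m A" for u
    using that mfold_sumset_subset_nat_span mfold_sumset_reflect_iff[of "int m * l - u" m l A]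
    by auto
  then show ?thesis
    unfolding set_eq_iff mem_iff structured_def using mfold_sumset_subset_nat_span by blast
qed

lemma tight_sum_mod_neq_zero:
  assumes "tight A l X" "X \<noteq> {#}"
  shows "sum_mset X mod l \<noteq> 0"
proof
  assume "sum_mset X mod l = 0"
  then have "extends_to l {#} (size X) (sum_mset X)"
    using sum_mset_nonneg cosum_nonneg tight_imp_subset[OF assms(1)] l_pos
    by (simp add: extends_to_iff cosum_eq)
  then show False using tight_size_le[OF assms(1), of "{#}"] assms(2) by simp
qed

lemma tight_elem:
  assumes "tight A l X" "a \<in># X"
  shows "0 < a" "a < l"
proof -
  have "a mod l \<noteq> 0"
    using tight_sum_mod_neq_zero[OF tight_mono[OF assms(1), of "{#a#}"]] assms(2) by simp
  moreover have "a \<in> {0..l}"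
    using assms tight_imp_subset subset_atLeastAtMost by blast
  ultimately show "0 < a" "a < l" by (auto simp: order_less_le)
qed

lemma tight_sum_bounds:
  assumes "tight A l X"
  shows "int (size X) \<le> sum_mset X" "sum_mset X \<le> int (size X) * (l - 1)"
proof -
  have "int (size X) \<le> sum_mset X \<and> sum_mset X \<le> int (size X) * (l - 1)"
    using assms
  proof (induction X)
    case (add a X)
    then have "tight A l X" "0 < a" "a < l"
      using tight_mono[of A l "add_mset a X" X] tight_elem[of "add_mset a X" a] by auto
    then show ?case using add.IH by (simp add: algebra_simps)
  qed simp
  then show "int (size X) \<le> sum_mset X" "sum_mset X \<le> int (size X) * (l - 1)" by auto
qed

lemma tight_sum_mod_notin:
  assumes "tight A l X" "size X \<ge> 2"
  shows "sum_mset X mod l \<notin> A"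
proof
  assume residue_in: "sum_mset X mod l \<in> A"
  define c d where "c = sum_mset X mod l" and "d = sum_mset X div l"
  have sum_X: "sum_mset X = d * l + c" and "c \<ge> 0"
    using l_pos by (simp_all add: c_def d_def)
  have "sum_mset X < int (size X) * l"
    using tight_sum_bounds(2)[OF assms(1)] assms(2) by (simp add: algebra_simps)
  then have "d * l < int (size X) * l" using sum_X \<open>c \<ge> 0\<close> by linarith
  then have "d + 1 \<le> int (size X)" using l_pos by simp
  then have "(d + 1) * l \<le> int (size X) * l" using l_pos by (intro mult_right_mono) auto
  then have "cosum l {#c#} \<le> int (size X) * l - sum_mset X"
    using sum_X by (simp add: algebra_simps)
  moreover have "c \<le> sum_mset X"
    using tight_sum_bounds(1)[OF assms(1)] by (simp add: c_def zmod_le_nonneg_dividend)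
  ultimately have "extends_to l {#c#} (size X) (sum_mset X)"
    using l_pos by (simp add: extends_to_iff c_def)
  then show False
    using tight_size_le[OF assms(1), of "{#c#}"] residue_in assms(2) by (simp add: c_def)
qed

lemma tight_subsum_eq:
  assumes "tight A l Z" "Y \<subseteq># Z" "X \<subseteq># Y" "sum_mset X mod l = sum_mset Y mod l"
  shows "X = Y"
proof (rule ccontr)
  assume "X \<noteq> Y"
  obtain W where Y: "Y = X + W" using assms(3) by (metis subset_mset.le_iff_add)
  then have "W \<noteq> {#}" using \<open>X \<noteq> Y\<close> by auto
  moreover have "W \<subseteq># Z"
    using assms(2) Y mset_subset_eq_add_right subset_mset.order_trans by blast
  then have "tight A l W" by (rule tight_mono[OF assms(1)])
  moreover have "l dvd sum_mset W"
    using assms(4)[symmetric] unfolding mod_eq_dvd_iff by (simp add: Y)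
  ultimately show False using tight_sum_mod_neq_zero[of W] by simp
qed

definition prefix_residue :: "int list \<Rightarrow> nat \<Rightarrow> int" where
  "prefix_residue xs q = sum_list (take q xs) mod l"

definition prefix_residues :: "int list \<Rightarrow> int set" where
  "prefix_residues xs = prefix_residue xs ` {1..length xs}"

lemma finite_prefix_residues: "finite (prefix_residues xs)"
  by (simp add: prefix_residues_def)

lemma tight_take: "tight A l (mset xs) \<Longrightarrow> tight A l (mset (take q xs))"
  and tight_drop: "tight A l (mset xs) \<Longrightarrow> tight A l (mset (drop q xs))"
  by (metis append_take_drop_id mset_append tight_mono mset_subset_eq_add_left mset_subset_eq_add_right)+

lemma inj_on_prefix_residue:
  assumes "tight A l (mset xs)"
  shows "inj_on (prefix_residue xs) {..length xs}"
proof (rule linorder_inj_onI')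
  fix p q assume pq: "p \<in> {..length xs}" "q \<in> {..length xs}" "p < q"
  then have "mset (take p xs) \<noteq> mset (take q xs)"
    by (metis atMost_iff length_take min_absorb2 nat_neq_iff size_mset)
  then show "prefix_residue xs p \<noteq> prefix_residue xs q"
    using tight_subsum_eq[OF tight_take[OF assms, of q] _ mset_take_mono[of p q xs]] pq(3)
    by (auto simp: prefix_residue_def sum_mset_sum_list)
qed

lemma card_prefix_residues:
  assumes "tight A l (mset xs)"
  shows "card (prefix_residues xs) = length xs"
  unfolding prefix_residues_def
  using inj_on_subset[OF inj_on_prefix_residue[OF assms], of "{1..length xs}"]
  by (subst card_image) auto

lemma prefix_residues_subset:
  assumes "tight A l (mset xs)"
  shows "prefix_residues xs \<subseteq> {0<..<l}"
proof
  fix w assume "w \<in> prefix_residues xs"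
  then obtain q where "1 \<le> q" "q \<le> length xs" "w = sum_mset (mset (take q xs)) mod l"
    by (auto simp: prefix_residues_def prefix_residue_def sum_mset_sum_list)
  moreover from this have "mset (take q xs) \<noteq> {#}" by auto
  ultimately have "w \<noteq> 0"
    using tight_sum_mod_neq_zero[OF tight_take[OF assms, of q]] by simp
  moreover have "0 \<le> w" "w < l" using l_pos \<open>w = _\<close> by simp_all
  ultimately show "w \<in> {0<..<l}" by simp
qed

lemma prefix_residues_Int:
  assumes "tight A l (mset xs)"
  shows "prefix_residues xs \<inter> A \<subseteq> {prefix_residue xs 1}"
proof
  fix w assume w: "w \<in> prefix_residues xs \<inter> A"
  then obtain q where q: "1 \<le> q" "q \<le> length xs" "w = prefix_residue xs q"
    by (auto simp: prefix_residues_def)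
  then have "size (mset (take q xs)) < 2"
    using tight_sum_mod_notin[OF tight_take[OF assms, of q]] w
    by (force simp: prefix_residue_def sum_mset_sum_list)
  then have "q = 1" using q by simp
  then show "w \<in> {prefix_residue xs 1}" using q by simp
qed

lemma prefix_residues_complement:
  assumes "tight A l (mset xs)" "w \<in> prefix_residues xs" "(sum_list xs - w) mod l \<in> A"
  shows "w \<in> {prefix_residue xs (length xs - 1), sum_list xs mod l}"
proof -
  obtain q where q: "1 \<le> q" "q \<le> length xs" "w = prefix_residue xs q"
    using assms(2) by (auto simp: prefix_residues_def)
  have "sum_list xs = sum_list (take q xs) + sum_list (drop q xs)"
    by (metis append_take_drop_id sum_list_append)
  then have "(sum_list xs - w) mod l = sum_list (drop q xs) mod l"
    unfolding q(3) prefix_residue_def mod_diff_right_eq by simp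
  then have "sum_mset (mset (drop q xs)) mod l \<in> A"
    using assms(3) by (simp add: sum_mset_sum_list)
  then have "size (mset (drop q xs)) < 2"
    using tight_sum_mod_notin[OF tight_drop[OF assms(1), of q]] by force
  then have "q = length xs - 1 \<or> q = length xs" using q by auto
  then show ?thesis using q by (auto simp: prefix_residue_def)
qed

end


section \<open>Sets with an isolated one\<close>

context normalized_set
begin

lemma tight_sum_less_ex_hole_pairs:
  assumes "tight A l X" "sum_mset X < l" "size X \<ge> 3"
  obtains W where "size X \<le> card W + 3"
    and "\<And>w. w \<in> W \<Longrightarrow> w \<in> {0<..<sum_mset X} - A \<and> sum_mset X - w \<notin> A"
proof -
  obtain xs where xs: "mset xs = X" using ex_mset by blast
  define u where "u = sum_mset X"
  note tight_xs = assms(1)[folded xs]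
  have length_xs: "length xs = size X" and sum_xs: "sum_list xs = u"
    using xs by (auto simp: u_def sum_mset_sum_list)
  have u: "0 < u" "u < l"
    using tight_sum_bounds(1)[OF assms(1)] assms(2,3) by (auto simp: u_def)
  let ?ends = "{prefix_residue xs 1, prefix_residue xs (size X - 1), u}"
  define W where "W = prefix_residues xs - ?ends"
  have "card ?ends \<le> 3" by (simp add: card_insert_if)
  then have "size X \<le> card W + 3"
    using card_prefix_residues[OF tight_xs] length_xs
      diff_card_le_card_Diff[of ?ends "prefix_residues xs"] by (simp add: W_def)
  moreover have "w \<in> {0<..<u} - A \<and> u - w \<notin> A" if "w \<in> W" for w
  proof
    have w: "w \<in> prefix_residues xs" using that by (simp add: W_def)
    then obtain q where q: "w = sum_list (take q xs) mod l"
      by (auto simp: prefix_residues_def prefix_residue_def)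
    have "mset (take q xs) \<subseteq># X"
      using mset_take_mono[of q "length xs + q" xs] xs by simp
    then have "0 \<le> sum_list (take q xs)" "sum_list (take q xs) \<le> u"
      using tight_imp_subset[OF assms(1)] tight_imp_subset[OF tight_take[OF tight_xs, of q]]
        sum_mset_mono_subset[of "mset (take q xs)" X] sum_mset_nonneg[of "mset (take q xs)"]
      by (auto simp: u_def sum_mset_sum_list)
    then have "w \<le> u" unfolding q using zmod_le_nonneg_dividend order_trans by blast
    then show "w \<in> {0<..<u} - A"
      using that w prefix_residues_subset[OF tight_xs] prefix_residues_Int[OF tight_xs]
      by (force simp: W_def)
    then have "(u - w) mod l = u - w" using u by (intro mod_pos_pos_trivial) auto
    then show "u - w \<notin> A"
      using that prefix_residues_complement[OF tight_xs w] u by (auto simp: W_def sum_xs length_xs)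
  qed
  ultimately show thesis using that[of W] by (simp add: u_def)
qed

lemma tight_sum_less_imp_le_card_holes:
  assumes "tight A l X" "sum_mset X < l" "size X \<ge> 3"
  shows "sum_mset X + int (size X) \<le> 2 * int (card holes) + 2"
proof -
  define u where "u = sum_mset X"
  obtain W where card_W: "size X \<le> card W + 3"
    and W: "\<And>w. w \<in> W \<Longrightarrow> w \<in> {0<..<u} - A \<and> u - w \<notin> A"
    using tight_sum_less_ex_hole_pairs[OF assms] unfolding u_def by blast
  have u: "0 < u" "u < l" "u \<notin> A"
    using tight_sum_bounds(1)[OF assms(1)] tight_sum_mod_notin[OF assms(1)] assms(2,3)
    by (auto simp: u_def)
  have complement: "u - c \<notin> A" if "c \<in> A" for c
    using tight_size_le_if_sum_eq[OF assms(1), of "{#c, u - c#}"] that assms(3) by (auto simp: u_def)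
  define V where "V = (-) u ` ({0<..<u} \<inter> A)"
  have V: "w \<in> {0<..<u} - A \<and> u - w \<in> A" if "w \<in> V" for w
    using that complement by (auto simp: V_def)
  have "V \<union> W \<subseteq> {0<..<u} - A" "V \<inter> W = {}" using V W by blast+
  then have "card V + card W \<le> card ({0<..<u} - A)"
    by (metis card_Un_disjoint card_mono finite_Diff finite_Un finite_greaterThanLessThan_int finite_subset)
  moreover have "card V = card ({0<..<u} \<inter> A)"
    by (simp add: V_def card_image)
  moreover have "card ({0<..<u} \<inter> A) + card ({0<..<u} - A) = nat (u - 1)"
    using card_Int_Diff[of "{0<..<u}" A] by simp
  moreover have "card (insert u ({0<..<u} - A)) \<le> card holes"
    using u by (intro card_mono) (auto simp: holes_def)
  ultimately show ?thesis using card_W u(1) unfolding u_def[symmetric] by simp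
qed

lemma tight_replicate_one_gap:
  assumes "tight A l X" "replicate_mset k 1 \<subseteq># X" "a \<in> A" "a \<ge> 2"
  shows "int k < a"
proof (rule ccontr)
  assume "\<not> int k < a"
  then have "replicate_mset (nat a) 1 \<subseteq># replicate_mset k (1 :: int)"
    by (simp add: subseteq_mset_def)
  then have "tight A l (replicate_mset (nat a) 1)"
    using assms(1,2) tight_mono subset_mset.order_trans by blast
  moreover have "2 \<le> nat a" using assms(4) by simp
  ultimately show False
    using tight_sum_mod_notin[of "replicate_mset (nat a) 1"] mod_in assms(3,4) by simp
qed

lemma tight_eq_replicate_one:
  assumes "tight A l X" "sum_mset X + 2 \<le> 2 * int (size X)"
  shows "X = replicate_mset (size X) 1"
proof -
  define k Z where "k = count X 1" and "Z = filter_mset (\<lambda>a. a \<noteq> 1) X"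
  have X: "X = replicate_mset k 1 + Z"
    unfolding k_def Z_def by (rule multiset_eqI) auto
  have Z_ge_2: "a \<ge> 2" if "a \<in># Z" for a
    using that tight_elem(1)[OF assms(1), of a] by (auto simp: Z_def)
  have sum_Z_ge: "int (size Z) * b \<le> sum_mset Z" if "\<And>a. a \<in># Z \<Longrightarrow> a \<ge> b" for b
    using sum_mset_mono[of Z "\<lambda>_. b" "\<lambda>a. a"] that by simp
  have "k \<ge> 1" using sum_Z_ge[of 2] Z_ge_2 assms(2) X by simp
  have "Z = {#}"
  proof (rule ccontr)
    assume "Z \<noteq> {#}"
    then have "size Z \<ge> 1" by (simp add: Suc_le_eq nonempty_has_size)
    have "int k + 1 \<le> a" if "a \<in># Z" for a
      using tight_replicate_one_gap[OF assms(1), of k a] Z_ge_2[OF that] X that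
        tight_imp_subset[OF assms(1)] by auto
    then have "int (size Z) * (int k + 1) \<le> sum_mset Z" by (rule sum_Z_ge)
    moreover have "(int (size Z) - 1) * (int k - 1) \<ge> 0"
      using \<open>size Z \<ge> 1\<close> \<open>k \<ge> 1\<close> by simp
    moreover have "sum_mset X = int k + sum_mset Z" "size X = k + size Z" using X by auto
    ultimately show False using assms(2) by (simp add: algebra_simps)
  qed
  then show ?thesis using X by simp
qed

lemma tight_sum_less_imp_isolated_one:
  assumes "tight A l X" "sum_mset X < l" "size X = Suc m" "m \<ge> 2"
    and "2 * card holes + 2 \<le> 3 * m"
  shows "isolated_one A l m"
proof -
  have "sum_mset X + 2 \<le> 2 * int (size X)"
    using tight_sum_less_imp_le_card_holes[OF assms(1,2)] assms(3-5) by simp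
  then have X: "X = replicate_mset (Suc m) 1"
    using tight_eq_replicate_one[OF assms(1)] assms(3) by simp
  have "a \<in> {0, 1} \<union> {int m + 2..l}" if "a \<in> A" for a
    using tight_replicate_one_gap[OF assms(1), of "Suc m" a] X that subset_atLeastAtMost by force
  moreover have "1 \<in> A" using X tight_imp_subset[OF assms(1)] by simp
  ultimately show ?thesis unfolding isolated_one_def using zero_in by blast
qed

lemma isolated_one_imp_notin_mfold_sumset:
  assumes "isolated_one A l m"
  shows "int m + 1 \<notin> mfold_sumset m A"
proof
  assume "int m + 1 \<in> mfold_sumset m A"
  then obtain X where X: "set_mset X \<subseteq> A" "size X = m" "sum_mset X = int m + 1"
    unfolding mfold_sumset_eq_sum_mset by auto
  have "a \<le> 1" if "a \<in># X" for a
  proof -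
    have "a \<le> int m + 1" using sum_mset_mono_subset[of "{#a#}" X] that X by simp
    then show ?thesis using assms that X(1) unfolding isolated_one_def by force
  qed
  then have "sum_mset X \<le> int (size X)"
    using sum_mset_mono[of X "\<lambda>a. a" "\<lambda>_. 1"] by simp
  then show False using X(2,3) by simp
qed

lemma isolated_one_imp_not_structured:
  assumes "isolated_one A l m" "m \<ge> 1" "card A \<ge> 4" "l + 4 < 2 * int (card A) + int m"
  shows "\<not> structured A l m"
proof -
  define K where "K = A \<inter> {int m + 2..l - 1}"
  have "A \<subseteq> {0, 1, l} \<union> K"
    using assms(1) unfolding isolated_one_def K_def by force
  then have "card A \<le> card ({0, 1, l} \<union> K)" by (intro card_mono) (auto simp: K_def)
  also have "\<dots> \<le> card {0, 1, l} + card K" by (rule card_Un_le)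
  also have "\<dots> \<le> 3 + card K" by (simp add: card_insert_if)
  finally have "card {int m + 2..l - 1} < 2 * card K" using assms(3,4) by simp
  then obtain c where c: "c \<in> A" "int m + 1 + l - c \<in> A"
    by (rule ex_symmetric_pair[rotated]) (auto simp: K_def algebra_simps)
  define X Y where "X = replicate_mset (Suc m) (1 :: int)"
    and "Y = {#c, int m + 1 + l - c#} + replicate_mset (m - 1) 0"
  have "set_mset X \<subseteq> A" "sum_mset X = int m + 1"
    using assms(1) by (auto simp: isolated_one_def X_def)
  then have "int m + 1 \<in> nat_span A" by (metis nat_spanI)
  moreover have "set_mset Y \<subseteq> A" "cosum l Y = int m * l - (int m + 1)"
    using c zero_in assms(2) by (auto simp: Y_def cosum_eq algebra_simps of_nat_diff split: if_splits)
  then have "int m * l - (int m + 1) \<in> nat_span ((-) l ` A)" by (metis nat_span_reflectI)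
  ultimately show ?thesis
    using isolated_one_imp_notin_mfold_sumset[OF assms(1)] unfolding structured_def by blast
qed

end


section \<open>Critical sums and their walks\<close>

context normalized_set
begin

lemma not_structured_imp_gap:
  assumes "\<not> structured A l m"
  obtains k u where "m \<le> k" "u \<notin> mfold_sumset k A"
    "u \<in> mfold_sumset (Suc k) A" "u + l \<in> mfold_sumset (Suc k) A"
proof -
  obtain v X Y where X: "set_mset X \<subseteq> A" "sum_mset X = v"
    and Y: "set_mset Y \<subseteq> A" "cosum l Y = int m * l - v" and v: "v \<notin> mfold_sumset m A"
    using assms unfolding structured_def nat_span_reflect unfolding nat_span_def by force
  let ?P = "\<lambda>i. v + int i * l \<in> mfold_sumset (m + i) A"
  have "extends_to l Y (m + size Y) (v + int (size Y) * l)"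
    using Y(2) by (intro extends_toI[of _ m 0]) (simp_all add: cosum_eq)
  then have "?P (size Y)" using Y(1) mfold_sumset_iff_extends_to by blast
  then obtain i where i: "\<not> ?P i" "?P (Suc i)"
    using ex_least_nat_less[of ?P] v by auto
  define u where "u = v + int i * l"
  let ?Q = "\<lambda>j. u \<in> mfold_sumset (m + i + j) A"
  have "extends_to l X (m + i + size X) u"
    using X(2) by (intro extends_toI[of _ i m]) (simp_all add: u_def)
  then have "?Q (size X)" using X(1) mfold_sumset_iff_extends_to by blast
  then obtain j where j: "\<not> ?Q j" "?Q (Suc j)"
    using ex_least_nat_less[of ?Q] i(1) by (auto simp: u_def)
  have "u + l \<in> mfold_sumset (Suc (m + i)) A" using i(2) by (simp add: u_def algebra_simps)
  then have "u + l \<in> mfold_sumset (Suc (m + i + j)) A"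
    by (rule subsetD[OF mfold_sumset_mono, rotated]) simp
  then show thesis using that[of "m + i + j" u] j by simp
qed

lemma ex_tight_cosum_eq:
  assumes "u \<notin> mfold_sumset k A" "u \<in> mfold_sumset (Suc k) A"
  obtains E where "tight A l E" "cosum l E = int (Suc k) * l - u" "sum_mset E \<le> u"
proof -
  obtain E where E: "tight A l E" "extends_to l E (Suc k) u"
    using assms(2) unfolding mfold_sumset_iff_extends_to by (metis ex_tight_extends_to)
  then obtain p q where pq: "size E + p + q = Suc k" "sum_mset E + int p * l = u"
    unfolding extends_to_def by blast
  have "q = 0"
  proof (rule ccontr)
    assume "q \<noteq> 0"
    then have "extends_to l E k u" using pq by (intro extends_toI[of _ p "q - 1"]) auto
    then show False
      using assms(1) tight_imp_subset[OF E(1)] mfold_sumset_iff_extends_to by blast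
  qed
  then have "Suc k = size E + p" using pq(1) by simp
  then have "cosum l E = int (Suc k) * l - u"
    using pq(2) by (simp only: cosum_eq) (simp add: algebra_simps)
  moreover have "sum_mset E \<le> u" using E(2) extends_to_iff[OF l_pos] by blast
  ultimately show thesis using that E(1) by blast
qed

end

text \<open>
  Padding \<open>E\<close> to \<open>m + 1\<close> summands with sum \<open>u\<close> takes copies of \<open>l\<close> only, and padding \<open>G\<close> to
  \<open>m + 1\<close> summands with sum \<open>u + l\<close> takes copies of \<open>0\<close> only; this is what the conditions on
  \<open>cosum l E\<close> and \<open>sum_mset G\<close> say.
\<close>

locale critical_sum = normalized_set +
  fixes m :: nat and u :: int and E G :: "int multiset"
  assumes tight_E: "tight A l E" and cosum_E: "cosum l E = int (Suc m) * l - u"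
    and sum_E_le: "sum_mset E \<le> u"
    and tight_G: "tight A l G" and sum_G: "sum_mset G = u + l"
    and cosum_G_le: "cosum l G \<le> int m * l - u"
    and u_notin: "u \<notin> mfold_sumset m A"

lemma (in normalized_set) not_structured_imp_critical_sum:
  assumes "\<not> structured A l m"
  obtains k u E G where "m \<le> k" "critical_sum A l k u E G"
proof -
  interpret B: normalized_set "(-) l ` A" l by (rule normalized_set_reflect)
  obtain k u where k: "m \<le> k" and u: "u \<notin> mfold_sumset k A"
    "u \<in> mfold_sumset (Suc k) A" "u + l \<in> mfold_sumset (Suc k) A"
    using not_structured_imp_gap[OF assms] .
  obtain E where E: "tight A l E" "cosum l E = int (Suc k) * l - u" "sum_mset E \<le> u"
    using ex_tight_cosum_eq[OF u(1,2)] .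
  have "int k * l - u \<notin> mfold_sumset k ((-) l ` A)"
    and "int k * l - u \<in> mfold_sumset (Suc k) ((-) l ` A)"
    using u(1,3) by (simp_all add: mfold_sumset_reflect_iff algebra_simps)
  then obtain F where F: "tight ((-) l ` A) l F"
    "cosum l F = int (Suc k) * l - (int k * l - u)" "sum_mset F \<le> int k * l - u"
    by (rule B.ex_tight_cosum_eq)
  then have "tight A l (image_mset ((-) l) F)" using tight_reflect[OF F(1)] by simp
  then have "critical_sum A l k u E (image_mset ((-) l) F)"
    using E F(2,3) u(1) by unfold_locales (auto simp: algebra_simps)
  then show thesis using that k by blast
qed

context critical_sum
begin

lemma set_E: "set_mset E \<subseteq> A" and set_G: "set_mset G \<subseteq> A"
  using tight_E tight_G tight_imp_subset by blast+

lemma sum_E_mod: "sum_mset E mod l = u mod l" and sum_G_mod: "sum_mset G mod l = u mod l"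
proof -
  have "sum_mset E = u + (int (size E) - int (Suc m)) * l"
    using cosum_E by (simp add: cosum_eq algebra_simps)
  then show "sum_mset E mod l = u mod l" by (simp only: mod_mult_self1)
  show "sum_mset G mod l = u mod l" by (simp add: sum_G)
qed

lemma u_bounds: "0 \<le> u" "u \<le> int m * l"
  using sum_mset_nonneg[OF set_E] sum_E_le cosum_nonneg[OF set_G] cosum_G_le by linarith+

lemma critical_sum_reflect:
  "critical_sum ((-) l ` A) l m (int m * l - u) (image_mset ((-) l) G) (image_mset ((-) l) E)"
proof -
  interpret B: normalized_set "(-) l ` A" l by (rule normalized_set_reflect)
  show ?thesis
    by unfold_locales
      (use tight_reflect[OF tight_E] tight_reflect[OF tight_G] cosum_E sum_E_le sum_G cosum_G_le u_notin
        in \<open>auto simp: mfold_sumset_reflect_iff algebra_simps\<close>)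
qed

lemma sum_ge_or_cosum_ge:
  assumes "set_mset X \<subseteq> A" "sum_mset X mod l = u mod l"
  shows "u + l \<le> sum_mset X \<or> int (Suc m) * l - u \<le> cosum l X"
proof -
  obtain d where "sum_mset X - u = l * d" using assms(2) by (metis mod_eq_dvd_iff dvdE)
  then have sum_X: "sum_mset X = u + d * l" by (simp add: algebra_simps)
  then have cosum_X: "cosum l X = (int (size X) - d) * l - u" by (simp add: cosum_eq algebra_simps)
  consider "d \<ge> 1" | "int (Suc m) \<le> int (size X) - d" | "d \<le> 0" "int (size X) - d \<le> int m"
    by linarith
  then show ?thesis
  proof cases
    case 1
    then show ?thesis using sum_X l_pos mult_right_mono[of 1 d l] by simp
  next
    case 2
    then show ?thesis using cosum_X l_pos mult_right_mono[of "int (Suc m)" "int (size X) - d" l] by simp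
  next
    case 3
    then have "extends_to l X m u"
      using sum_X by (intro extends_toI[of _ "nat (- d)" "nat (int m - (int (size X) - d))"]) auto
    then show ?thesis using assms(1) u_notin mfold_sumset_iff_extends_to by blast
  qed
qed

definition link :: "int multiset \<Rightarrow> int multiset \<Rightarrow> bool" where
  "link X Y \<longleftrightarrow> X \<subseteq># E \<and> Y \<subseteq># G \<and> sum_mset X mod l = sum_mset Y mod l"

lemma link_imp_subset:
  assumes "link X Y"
  shows "set_mset X \<subseteq> A" "set_mset Y \<subseteq> A"
  using assms set_E set_G unfolding link_def by (blast dest: set_mset_mono)+

text \<open>
  Linked parts can be exchanged: \<open>X + (G - Y)\<close> and \<open>(E - X) + Y\<close> both lie in the class of \<open>u\<close>.
\<close>

lemma link_exchange_G:
  assumes "link X Y"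
  shows "sum_mset Y \<le> sum_mset X \<or> int (Suc m) * l - u + cosum l Y \<le> cosum l X + cosum l G"
proof -
  obtain Y' where G: "G = Y + Y'" using assms by (metis link_def subset_mset.le_iff_add)
  have "sum_mset (X + Y') mod l = u mod l"
    using assms sum_G_mod unfolding link_def by (metis G mod_add_left_eq sum_mset.union)
  moreover have "set_mset (X + Y') \<subseteq> A"
    using link_imp_subset(1)[OF assms] set_G G by simp
  ultimately have "u + l \<le> sum_mset (X + Y') \<or> int (Suc m) * l - u \<le> cosum l (X + Y')"
    by (intro sum_ge_or_cosum_ge)
  then show ?thesis using sum_G unfolding G by auto
qed

lemma link_exchange_E:
  assumes "link X Y"
  shows "cosum l X \<le> cosum l Y \<or> u + l + sum_mset X \<le> sum_mset E + sum_mset Y"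
proof -
  obtain X' where E: "E = X + X'" using assms by (metis link_def subset_mset.le_iff_add)
  have "sum_mset (X' + Y) mod l = u mod l"
    using assms sum_E_mod unfolding link_def by (metis E add.commute mod_add_left_eq sum_mset.union)
  moreover have "set_mset (X' + Y) \<subseteq> A"
    using link_imp_subset(2)[OF assms] set_E E by simp
  ultimately have "u + l \<le> sum_mset (X' + Y) \<or> int (Suc m) * l - u \<le> cosum l (X' + Y)"
    by (intro sum_ge_or_cosum_ge)
  then show ?thesis using cosum_E unfolding E by auto
qed

lemma link_sum_le_iff_cosum_le:
  assumes "link X Y"
  shows "sum_mset Y \<le> sum_mset X \<longleftrightarrow> cosum l X \<le> cosum l Y"
  using link_exchange_G[OF assms] link_exchange_E[OF assms] sum_E_le cosum_G_le l_pos
  by (auto simp: algebra_simps)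

text \<open>
  A walk runs along \<open>E\<close> through \<open>E1\<close> to \<open>E2\<close> and then along \<open>G\<close> from \<open>G1\<close> through \<open>G2\<close> to \<open>G\<close>;
  the two parts pass through common classes at \<open>E1, G1\<close> and at \<open>E2, G2\<close>. On a shortest walk there
  are no further common classes, since exchanging parts there would give a shorter one.
\<close>

definition walk :: "int multiset \<Rightarrow> int multiset \<Rightarrow> int multiset \<Rightarrow> int multiset \<Rightarrow> bool" where
  "walk E1 E2 G1 G2 \<longleftrightarrow> E1 \<subseteq># E2 \<and> G1 \<subseteq># G2 \<and> link E1 G1 \<and> link E2 G2 \<and>
    sum_mset G1 \<le> sum_mset E1 \<and> sum_mset E2 < sum_mset G2"

definition walk_length :: "int multiset \<Rightarrow> int multiset \<Rightarrow> nat" where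
  "walk_length E2 G1 = size E2 + (size G - size G1)"

definition shortest_walk :: "int multiset \<Rightarrow> int multiset \<Rightarrow> int multiset \<Rightarrow> int multiset \<Rightarrow> bool" where
  "shortest_walk E1 E2 G1 G2 \<longleftrightarrow> walk E1 E2 G1 G2 \<and>
    (\<forall>E1' E2' G1' G2'. walk E1' E2' G1' G2' \<longrightarrow> walk_length E2 G1 \<le> walk_length E2' G1')"

lemma walk_length_ge:
  assumes "walk E1 E2 G1 G2"
  shows "m + 3 \<le> walk_length E2 G1"
proof -
  have E: "E1 \<subseteq># E2" "E2 \<subseteq># E" and G: "G1 \<subseteq># G2" "G2 \<subseteq># G"
    and links: "link E1 G1" "link E2 G2"
    and sums: "sum_mset G1 \<le> sum_mset E1" "sum_mset E2 < sum_mset G2"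
    using assms by (auto simp: walk_def link_def)
  have "E1 \<noteq> E2"
  proof
    assume "E1 = E2"
    then have "G1 = G2" using tight_subsum_eq[OF tight_G G(2,1)] links by (simp add: link_def)
    then show False using sums \<open>E1 = E2\<close> by simp
  qed
  obtain Z where Z: "E2 = E1 + Z" using E(1) by (metis subset_mset.le_iff_add)
  then have "tight A l Z" using E(2) tight_E by (metis tight_mono mset_subset_eq_add_right)
  then have "sum_mset E1 < sum_mset E2"
    using tight_sum_bounds(1)[of Z] Z \<open>E1 \<noteq> E2\<close> by (cases "Z = {#}") (auto simp: nonempty_has_size)
  moreover have "cosum l G1 \<le> cosum l G2"
    using G(1) link_imp_subset(2)[OF links(2)] by (rule cosum_mono_subset)
  moreover have "int (Suc m) * l - u + cosum l G2 \<le> cosum l E2 + cosum l G"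
    using link_exchange_G[OF links(2)] sums(2) by simp
  ultimately have "int (m + 2) * l < (int (size E2) + (int (size G) - int (size G1))) * l"
    using sums(1) sum_G by (simp add: cosum_eq algebra_simps)
  then have "int (m + 2) < int (size E2) + (int (size G) - int (size G1))"
    using l_pos by (simp only: mult_less_cancel_right)
  then show ?thesis unfolding walk_length_def by linarith
qed

lemma ex_shortest_walk:
  obtains E1 E2 G1 G2 where "shortest_walk E1 E2 G1 G2"
proof -
  let ?P = "\<lambda>(E1, E2, G1, G2). walk E1 E2 G1 G2"
    and ?length = "\<lambda>(E1 :: int multiset, E2, G1, G2 :: int multiset). walk_length E2 G1"
  have "?P ({#}, E, {#}, G)"
    using sum_E_mod sum_G_mod sum_E_le sum_G l_pos by (simp add: walk_def link_def)
  from ex_has_least_nat[of ?P, OF this, of ?length] obtain E1 E2 G1 G2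
    where "walk E1 E2 G1 G2" "\<forall>y. ?P y \<longrightarrow> walk_length E2 G1 \<le> ?length y" by auto
  then show thesis by (intro that) (auto simp: shortest_walk_def)
qed

lemma shortest_walkD:
  assumes "shortest_walk E1 E2 G1 G2"
  shows "walk E1 E2 G1 G2"
    and "walk E1' E2' G1' G2' \<Longrightarrow> walk_length E2 G1 \<le> walk_length E2' G1'"
  using assms unfolding shortest_walk_def by blast+

lemma shortest_walk_link_sum_le:
  assumes "shortest_walk E1 E2 G1 G2" "link X Y" "X \<subseteq># E2" "G1 \<subset># Y"
    and "sum_mset Y \<le> sum_mset X"
  shows "\<not> Y \<subseteq># G2"
proof
  assume "Y \<subseteq># G2"
  then have "walk X E2 Y G2"
    using shortest_walkD(1)[OF assms(1)] assms(2,3,5) by (simp add: walk_def)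
  then have "walk_length E2 G1 \<le> walk_length E2 Y" by (rule shortest_walkD(2)[OF assms(1)])
  moreover have "size G1 < size Y" using assms(4) by (rule mset_subset_size)
  moreover have "size Y \<le> size G" using assms(2) by (simp add: link_def size_mset_mono)
  ultimately show False by (simp add: walk_length_def)
qed

lemma shortest_walk_link_sum_less:
  assumes "shortest_walk E1 E2 G1 G2" "link X Y" "X \<subset># E2" "G1 \<subseteq># Y"
    and "sum_mset X < sum_mset Y"
  shows "\<not> E1 \<subseteq># X"
proof
  assume "E1 \<subseteq># X"
  then have "walk E1 X G1 Y"
    using shortest_walkD(1)[OF assms(1)] assms(2,4,5) by (simp add: walk_def)
  then have "walk_length E2 G1 \<le> walk_length X G1" by (rule shortest_walkD(2)[OF assms(1)])
  moreover have "size X < size E2" using assms(3) by (rule mset_subset_size)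
  ultimately show False by (simp add: walk_length_def)
qed

lemma shortest_walk_crossing:
  assumes shortest: "shortest_walk E1 E2 G1 G2"
    and X: "X \<subseteq># E1 \<or> E1 \<subseteq># X" "X \<subseteq># E2"
    and Y: "G1 \<subset># Y" "Y \<subseteq># G" "Y \<subseteq># G2 \<or> G2 \<subseteq># Y"
    and same_class: "sum_mset X mod l = sum_mset Y mod l"
  shows "X = E2"
proof (rule ccontr)
  assume "X \<noteq> E2"
  have walk: "link E1 G1" "link E2 G2" "sum_mset G1 \<le> sum_mset E1" "sum_mset E2 < sum_mset G2"
    using shortest_walkD(1)[OF shortest] unfolding walk_def by blast+
  have link_XY: "link X Y"
    using X(2) Y(2) same_class walk(2) subset_mset.order_trans unfolding link_def by blast
  note subsets = link_imp_subset(1)[OF walk(1)] link_imp_subset(1)[OF walk(2)]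
    link_imp_subset(2)[OF link_XY]
  show False
  proof (cases "sum_mset Y \<le> sum_mset X")
    case True
    then have "\<not> Y \<subseteq># G2" by (rule shortest_walk_link_sum_le[OF shortest link_XY X(2) Y(1)])
    then have "sum_mset G2 \<le> sum_mset Y" using Y(3) sum_mset_mono_subset subsets by blast
    moreover have "sum_mset X \<le> sum_mset E2" using X(2) sum_mset_mono_subset subsets by blast
    ultimately show False using walk(4) True by simp
  next
    case False
    then have "\<not> E1 \<subseteq># X"
      using X(2) Y(1) \<open>X \<noteq> E2\<close>
      by (intro shortest_walk_link_sum_less[OF shortest link_XY])
        (auto simp: subset_mset.less_le)
    then have "cosum l X \<le> cosum l E1" using X(1) cosum_mono_subset subsets by blast
    moreover have "cosum l G1 \<le> cosum l Y"
      using Y(1) cosum_mono_subset subsets subset_mset.less_imp_le by blast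
    moreover have "cosum l E1 \<le> cosum l G1" "cosum l Y < cosum l X"
      using link_sum_le_iff_cosum_le walk(1,3) link_XY False by (auto simp: not_le[symmetric])
    ultimately show False by simp
  qed
qed

lemma shortest_walk_residues_Int:
  assumes shortest: "shortest_walk E1 E2 G1 G2"
    and xs: "mset (take (size E1) xs) = E1" "mset (take (size E2) xs) = E2"
    and ys: "mset ys = G" "mset (take (size G1) ys) = G1" "mset (take (size G2) ys) = G2"
  shows "prefix_residue xs ` {1..size E2} \<inter> prefix_residue ys ` {size G1<..size G} \<subseteq>
    {sum_mset E2 mod l}"
proof
  fix w assume "w \<in> prefix_residue xs ` {1..size E2} \<inter> prefix_residue ys ` {size G1<..size G}"
  then obtain p q where p: "p \<le> size E2" "w = prefix_residue xs p"
    and q: "size G1 < q" "q \<le> size G" "w = prefix_residue ys q" by auto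
  have length_ys: "length ys = size G" using arg_cong[OF ys(1), of size] by simp
  have "mset (take p xs) = E2"
  proof (rule shortest_walk_crossing[OF shortest])
    show "mset (take p xs) \<subseteq># E1 \<or> E1 \<subseteq># mset (take p xs)"
      using mset_take_mono[of p "size E1" xs] mset_take_mono[of "size E1" p xs] xs(1) by force
    show "mset (take p xs) \<subseteq># E2" using mset_take_mono[OF p(1)] xs(2) by metis
    have "G1 \<noteq> mset (take q ys)" using q length_ys by auto
    then show "G1 \<subset># mset (take q ys)"
      using mset_take_mono[of "size G1" q ys] ys(2) q(1) by (simp add: subset_mset.less_le)
    show "mset (take q ys) \<subseteq># G" using mset_take_mono[OF q(2), of ys] length_ys ys(1) by simp
    show "mset (take q ys) \<subseteq># G2 \<or> G2 \<subseteq># mset (take q ys)"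
      using mset_take_mono[of q "size G2" ys] mset_take_mono[of "size G2" q ys] ys(3) by force
    show "sum_mset (mset (take p xs)) mod l = sum_mset (mset (take q ys)) mod l"
      using p(2) q(3) by (simp add: prefix_residue_def sum_mset_sum_list)
  qed
  then show "w \<in> {sum_mset E2 mod l}"
    using p(2) by (auto simp: prefix_residue_def sum_mset_sum_list)
qed

lemma ex_lists_card_prefix_residues:
  obtains xs ys where "mset xs = E" "mset ys = G"
    "m + 2 \<le> card (prefix_residues xs \<union> prefix_residues ys)"
proof -
  obtain E1 E2 G1 G2 where shortest: "shortest_walk E1 E2 G1 G2" by (rule ex_shortest_walk)
  note walk = shortest_walkD(1)[OF shortest]
  then have sub: "E1 \<subseteq># E2" "E2 \<subseteq># E" "G1 \<subseteq># G2" "G2 \<subseteq># G" by (auto simp: walk_def link_def)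
  obtain xs where xs: "mset xs = E" "mset (take (size E1) xs) = E1" "mset (take (size E2) xs) = E2"
    using sub(1,2) by (rule ex_mset_prefixes)
  obtain ys where ys: "mset ys = G" "mset (take (size G1) ys) = G1" "mset (take (size G2) ys) = G2"
    using sub(3,4) by (rule ex_mset_prefixes)
  have size_E2: "size E2 \<le> length xs" and length_ys: "length ys = size G"
    using size_mset_mono[OF sub(2)] arg_cong[OF xs(1), of size] arg_cong[OF ys(1), of size] by simp_all
  define M N where "M = prefix_residue xs ` {1..size E2}"
    and "N = prefix_residue ys ` {size G1<..size G}"
  have "inj_on (prefix_residue xs) {1..size E2}"
    using inj_on_prefix_residue[of xs] tight_E xs(1) size_E2 by (auto elim!: inj_on_subset)
  then have "card M = size E2" by (simp add: M_def card_image)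
  moreover have "inj_on (prefix_residue ys) {size G1<..size G}"
    using inj_on_prefix_residue[of ys] tight_G ys(1) length_ys by (auto elim!: inj_on_subset)
  then have "card N = size G - size G1" by (simp add: N_def card_image)
  moreover have "card (M \<inter> N) \<le> 1"
    using card_mono[OF _ shortest_walk_residues_Int[OF shortest xs(2,3) ys]]
    by (simp add: M_def N_def)
  ultimately have "m + 2 \<le> card (M \<union> N)"
    using card_Un_Int[of M N] walk_length_ge[OF walk]
    by (simp add: walk_length_def M_def N_def)
  also have "\<dots> \<le> card (prefix_residues xs \<union> prefix_residues ys)"
  proof (rule card_mono)
    show "M \<union> N \<subseteq> prefix_residues xs \<union> prefix_residues ys"
      unfolding M_def N_def prefix_residues_def using size_E2 length_ys by auto
  qed (simp add: finite_prefix_residues)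
  finally show thesis using that xs(1) ys(1) by blast
qed

lemma two_sum_mod_neq:
  assumes "size E \<ge> 3" "size G \<ge> 3" "c \<in> A" "d \<in> A"
  shows "(c + d) mod l \<noteq> u mod l"
proof
  assume same_class: "(c + d) mod l = u mod l"
  have "E \<noteq> {#}" using assms(1) by auto
  then have "u mod l \<noteq> 0" using tight_sum_mod_neq_zero[OF tight_E] sum_E_mod by simp
  then have u: "0 < u" "u < int m * l" using u_bounds by (auto simp: order_less_le)
  obtain r where "c + d - u = l * r" using same_class by (metis mod_eq_dvd_iff dvdE)
  then have r: "c + d = u + r * l" by (simp add: algebra_simps)
  have "c \<le> l" "d \<le> l" "0 \<le> c" "0 \<le> d" using assms(3,4) subset_atLeastAtMost by auto
  from sum_ge_or_cosum_ge[of "{#c, d#}"] consider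
    "u + l \<le> c + d" | "int (Suc m) * l - u \<le> cosum l {#c, d#}"
    using same_class assms(3,4) by auto
  then show False
  proof cases
    case 1
    then have "1 * l \<le> r * l" using r by linarith
    moreover have "r * l < 2 * l" using r u \<open>c \<le> l\<close> \<open>d \<le> l\<close> by linarith
    ultimately have "r = 1" using l_pos by simp
    then have "sum_mset {#c, d#} = sum_mset G" using r sum_G by simp
    then show False
      using tight_size_le_if_sum_eq[OF tight_G, of "{#c, d#}"] assms by simp
  next
    case 2
    then have "r * l \<le> (1 - int m) * l" using r by (simp add: algebra_simps)
    then have "r \<le> 1 - int m" using l_pos by (simp only: mult_le_cancel_right)
    moreover have "(- int m) * l < r * l" using r u \<open>0 \<le> c\<close> \<open>0 \<le> d\<close> by simp
    then have "- int m < r" using l_pos by (simp only: mult_less_cancel_right)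
    ultimately have "r = 1 - int m" by simp
    then have "r * l = l - int m * l" by (simp add: left_diff_distrib)
    then have "cosum l {#c, d#} = cosum l E" using r cosum_E by (simp add: distrib_right)
    then show False
      using tight_size_le_if_cosum_eq[OF tight_E, of "{#c, d#}"] assms by simp
  qed
qed

definition complements :: "int set" where
  "complements = (\<lambda>c. (u - c) mod l) ` (A - {l})"

lemma complements_residue_in:
  assumes "w \<in> complements"
  shows "(u - w) mod l \<in> A"
proof -
  obtain c where c: "c \<in> A" "w = (u - c) mod l" using assms by (auto simp: complements_def)
  then have "(u - w) mod l = c mod l" by (simp add: mod_diff_right_eq)
  then show ?thesis using mod_in[OF c(1)] by simp
qed

lemma card_complements: "Suc (card complements) = card A"
proof -
  have "inj_on (\<lambda>c. (u - c) mod l) (A - {l})"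
  proof (rule inj_on_inverseI)
    fix c assume "c \<in> A - {l}"
    then have "c \<in> {0..<l}" using subset_atLeastAtMost by force
    then show "(u - (u - c) mod l) mod l = c" by (simp add: mod_diff_right_eq)
  qed
  then show ?thesis
    using card_Suc_Diff1[OF finite_A l_in] by (simp add: complements_def card_image)
qed

lemma complements_subset_holes:
  assumes "size E \<ge> 3" "size G \<ge> 3"
  shows "complements \<subseteq> holes"
proof
  fix w assume w: "w \<in> complements"
  then obtain c where c: "c \<in> A" "w = (u - c) mod l" by (auto simp: complements_def)
  then have "(c + w) mod l = u mod l" by (simp add: mod_add_right_eq)
  then have "w \<notin> A" using two_sum_mod_neq[OF assms c(1)] by blast
  then show "w \<in> holes" using c(2) l_pos by (simp add: holes_def order_less_imp_le)
qed

lemma card_prefix_residues_Int_le: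
  assumes "mset xs = E" "mset ys = G"
  shows "card ((prefix_residues xs \<union> prefix_residues ys) \<inter> A) \<le> 2"
proof -
  have "(prefix_residues xs \<union> prefix_residues ys) \<inter> A \<subseteq> {prefix_residue xs 1, prefix_residue ys 1}"
    using prefix_residues_Int[of xs] prefix_residues_Int[of ys] tight_E tight_G assms by auto
  then have "card ((prefix_residues xs \<union> prefix_residues ys) \<inter> A) \<le>
      card {prefix_residue xs 1, prefix_residue ys 1}" by (intro card_mono) auto
  also have "\<dots> \<le> 2" by (simp add: card_insert_if)
  finally show ?thesis .
qed

lemma card_prefix_residues_Int_complements_le:
  assumes "mset xs = E" "mset ys = G"
  shows "card ((prefix_residues xs \<union> prefix_residues ys) \<inter> complements) \<le> 3"
proof -
  have sums: "sum_list xs mod l = u mod l" "sum_list ys mod l = u mod l"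
    using sum_E_mod sum_G_mod assms by (auto simp: sum_mset_sum_list)
  let ?ends = "{u mod l, prefix_residue xs (length xs - 1), prefix_residue ys (length ys - 1)}"
  have "(prefix_residues xs \<union> prefix_residues ys) \<inter> complements \<subseteq> ?ends"
  proof
    fix w assume w: "w \<in> (prefix_residues xs \<union> prefix_residues ys) \<inter> complements"
    then have "(sum_list xs - w) mod l \<in> A" "(sum_list ys - w) mod l \<in> A"
      using complements_residue_in[of w] sums by (metis IntE mod_diff_left_eq)+
    then show "w \<in> ?ends"
      using w prefix_residues_complement[of xs w] prefix_residues_complement[of ys w]
        tight_E tight_G assms sums by auto
  qed
  then have "card ((prefix_residues xs \<union> prefix_residues ys) \<inter> complements) \<le> card ?ends"
    by (intro card_mono) auto
  also have "\<dots> \<le> 3" by (simp add: card_insert_if)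
  finally show ?thesis .
qed

lemma card_holes_ge:
  assumes "size E \<ge> 3" "size G \<ge> 3"
  shows "m + card A \<le> card holes + 4"
proof -
  obtain xs ys where xs: "mset xs = E" and ys: "mset ys = G"
    and card_residues: "m + 2 \<le> card (prefix_residues xs \<union> prefix_residues ys)"
    by (rule ex_lists_card_prefix_residues)
  define N where "N = prefix_residues xs \<union> prefix_residues ys"
  have fin: "finite N" "finite complements"
    using finite_A by (auto simp: N_def finite_prefix_residues complements_def)
  have "N \<subseteq> {0<..<l}"
    using prefix_residues_subset[of xs] prefix_residues_subset[of ys] tight_E tight_G xs ys
    by (auto simp: N_def)
  then have "(N - A) \<union> complements \<subseteq> holes"
    using complements_subset_holes[OF assms] by (force simp: holes_def)
  then have "card ((N - A) \<union> complements) \<le> card holes"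
    by (intro card_mono) (auto simp: holes_def)
  moreover have "card ((N - A) \<union> complements) + card ((N - A) \<inter> complements) =
      card (N - A) + card complements"
    using card_Un_Int[of "N - A" complements] fin by simp
  moreover have "card ((N - A) \<inter> complements) \<le> card (N \<inter> complements)"
    using fin by (intro card_mono) auto
  moreover have "card (N \<inter> A) + card (N - A) = card N"
    using card_Int_Diff[OF fin(1), of A] by simp
  ultimately show ?thesis
    using card_residues card_complements card_prefix_residues_Int_le[OF xs ys]
      card_prefix_residues_Int_complements_le[OF xs ys] unfolding N_def by linarith
qed

end


section \<open>The structure theorem\<close>

context critical_sum
begin

lemma size_G_le_two_imp_isolated_one:
  assumes "size G \<le> 2" "2 * card holes + 2 \<le> 3 * m"
  shows "isolated_one A l m"
proof -
  have "int (size G) * (l - 1) \<le> 1 * (l - 1)" if "size G \<le> 1"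
    using that l_pos by (intro mult_right_mono) auto
  then have "size G = 2"
    using tight_sum_bounds(2)[OF tight_G] sum_G u_bounds(1) assms(1) by force
  then have "u < l" using tight_sum_bounds(2)[OF tight_G] sum_G by simp
  have "sum_mset E = u"
    using sum_mset_nonneg[OF set_E] sum_E_le sum_E_mod u_bounds(1) \<open>u < l\<close> by simp
  then have "int (size E) * l = int (Suc m) * l" using cosum_E by (simp add: cosum_eq)
  then have "size E = Suc m" using l_pos by (simp only: mult_cancel_right of_nat_eq_iff) simp
  moreover have "sum_mset G mod l \<in> holes"
    using tight_sum_mod_notin[OF tight_G] \<open>size G = 2\<close> l_pos
    by (simp add: holes_def order_less_imp_le)
  then have "card holes > 0" by (auto simp: card_gt_0_iff holes_def)
  then have "m \<ge> 2" using assms(2) by linarith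
  ultimately show ?thesis
    using tight_sum_less_imp_isolated_one[OF tight_E] \<open>sum_mset E = u\<close> \<open>u < l\<close> assms(2) by simp
qed

lemma isolated_one_or_reflect:
  assumes "l + 5 < int m + 2 * int (card A)" "2 * l + 4 \<le> 3 * int m + 2 * int (card A)"
  shows "isolated_one A l m \<or> isolated_one ((-) l ` A) l m"
proof -
  interpret B: critical_sum "(-) l ` A" l m "int m * l - u"
    "image_mset ((-) l) G" "image_mset ((-) l) E"
    by (rule critical_sum_reflect)
  have "size G \<le> 2 \<or> size E \<le> 2"
    using card_holes_ge card_holes assms(1) by fastforce
  moreover have "2 * card holes + 2 \<le> 3 * m" "2 * card B.holes + 2 \<le> 3 * m"
    using assms(2) card_holes B.card_holes card_reflect[of l A] by linarith+
  ultimately show ?thesis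
    using size_G_le_two_imp_isolated_one B.size_G_le_two_imp_isolated_one by auto
qed

end

theorem (in normalized_set) structured_iff_not_isolated_one:
  assumes "card A \<ge> 4"
    and "l + 5 < int m + 2 * int (card A)" "2 * l + 4 \<le> 3 * int m + 2 * int (card A)"
  shows "structured A l m \<longleftrightarrow> \<not> isolated_one A l m \<and> \<not> isolated_one ((-) l ` A) l m"
proof (intro iffI conjI)
  interpret B: normalized_set "(-) l ` A" l by (rule normalized_set_reflect)
  have "m \<ge> 1" using assms(3) card_holes by linarith
  moreover have "l + 4 < 2 * int (card A) + int m" using assms(2) by simp
  moreover assume "structured A l m"
  ultimately show "\<not> isolated_one A l m" "\<not> isolated_one ((-) l ` A) l m"
    using isolated_one_imp_not_structured B.isolated_one_imp_not_structured assms(1)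
    by (auto simp: card_reflect)
next
  assume "\<not> isolated_one A l m \<and> \<not> isolated_one ((-) l ` A) l m"
  show "structured A l m"
  proof (rule ccontr)
    assume "\<not> structured A l m"
    then obtain k u E G where "m \<le> k" and "critical_sum A l k u E G"
      by (rule not_structured_imp_critical_sum)
    then have "isolated_one A l k \<or> isolated_one ((-) l ` A) l k"
      using assms(2,3) by (intro critical_sum.isolated_one_or_reflect) auto
    then show False
      using \<open>\<not> isolated_one A l m \<and> _\<close> \<open>m \<le> k\<close> isolated_one_antimono by blast
  qed
qed

lemma normalized_set_Max:
  fixes A :: "int set"
  assumes "finite A" "Min A = 0" "card A \<ge> 2"
  shows "normalized_set A (Max A)"
proof
  have "A \<noteq> {}" using assms(3) by auto
  then show "0 \<in> A" "Max A \<in> A" and subset: "A \<subseteq> {0..Max A}"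
    using Min_in Max_in Min_le Max_ge assms(1,2) by (metis, metis, metis atLeastAtMost_iff subsetI)
  show "Max A > 0"
  proof (rule ccontr)
    assume "\<not> Max A > 0"
    then have "A \<subseteq> {0}" using subset by force
    then have "card A \<le> 1" using card_mono[of "{0}" A] by simp
    then show False using assms(3) by simp
  qed
qed

theorem theorem4:
  fixes A E E' :: "int set" and l :: int and n m :: nat
  assumes "finite A"
    and "n = card A" and "n \<ge> 6"
    and "Min A = 0" and "Gcd A = 1"
    and "l = Max A"
    and "E = exceptional_set A"
    and "E' = exceptional_set ((\<lambda>a. l - a) ` A)"
    and "real m \<ge> max (real_of_int l - 3/2 * real n + 9/2) (2/3 * (real_of_int l - real n + 2))"
  shows "(\<not> ({0, 1} \<subseteq> A \<and> A \<subseteq> {0, 1} \<union> {int m + 2..l}) \<and>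
          \<not> ({l - 1, l} \<subseteq> A \<and> A \<subseteq> {0..l - (int m + 2)} \<union> {l - 1, l})
            \<longrightarrow> mfold_sumset m A = {0..int m * l} - (E \<union> (\<lambda>e. int m * l - e) ` E')) \<and>
         (({0, 1} \<subseteq> A \<and> A \<subseteq> {0, 1} \<union> {int m + 2..l}) \<or>
          ({l - 1, l} \<subseteq> A \<and> A \<subseteq> {0..l - (int m + 2)} \<union> {l - 1, l})
            \<longrightarrow> mfold_sumset m A \<noteq> {0..int m * l} - (E \<union> (\<lambda>e. int m * l - e) ` E'))"
proof -
  interpret normalized_set A l
    using normalized_set_Max assms by simp
  have "real_of_int (2 * int m) \<ge> real_of_int (2 * l - 3 * int n + 9)"
    and "real_of_int (3 * int m) \<ge> real_of_int (2 * l - 2 * int n + 4)"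
    using assms(9) by simp_all
  then have "2 * int m \<ge> 2 * l - 3 * int n + 9" "3 * int m \<ge> 2 * l - 2 * int n + 4"
    by (simp_all only: of_int_le_iff)
  then have "structured A l m \<longleftrightarrow> \<not> isolated_one A l m \<and> \<not> isolated_one ((-) l ` A) l m"
    using assms(2,3) by (intro structured_iff_not_isolated_one) auto
  moreover have "structured A l m \<longleftrightarrow>
      mfold_sumset m A = {0..int m * l} - (E \<union> (\<lambda>e. int m * l - e) ` E')"
    using mfold_sumset_eq_iff_structured assms(7,8) by simp
  ultimately show ?thesis
    unfolding isolated_one_reflect_iff isolated_one_def[of A] by blast
qed

end
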